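(* Let $(E_1,F_1)$ and $(E_2,F_2)$ be two pairs of dual spaces over the fields $K_1$ and $K_2$, respectively. If there exists an isomorphism $\psi$ of the lattice $L_{F_1}(E_1)$ onto the lattice $L_{F_2}(E_2)$, then $K_1$ and $K_2$ are isomorphic fields and there exists a semi-linear bijection $s:E_1\to E_2$ such that, for every $F_1$-closed subspace $M$ of $E_1$, $\psi(M)=s(M)$.
   Context: Fields are not assumed commutative (i.e. they are division rings). A pair of dual spaces $(E,F)$ over a field $K$ consists of a left vector space $E$ over $K$ and a right vector space $F$ over $K$ together with a nondegenerate bilinear form $\mathcal{B}$ on $E\times F$ (with values in $K$). For a subspace $A$ of $E$ put $A^\perp=\{y\in F\mid \mathcal{B}(x,y)=0 \text{ for every } x\in A\}$, and for a subspace $B$ of $F$ put $B^\perp=\{x\in E\mid \mathcal{B}(x,y)=0\text{ for every } y\in B\}$. A subspace $A$ of $E$ is called $F$-closed if $A=A^{\perp\perp}$. The set of all $F$-closed subspaces of $E$, ordered by inclusion, is a complete lattice denoted $L_F(E)$. A map $s:E_1\to E_2$ is semi-linear if it is additive and there is a field isomorphism $\sigma:K_1\to K_2$ with $s(\lambda x)=\sigma(\lambda)s(x)$ for all $\lambda\in K_1$, $x\in E_1$.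
   Formalization: The formal theorem assumes in addition that E_1 contains three linearly independent vectors (dim E_1 ≥ 3); without this the claim is false, e.g. the one-dimensional pairs (Q,Q) and (R,R) have isomorphic lattices {0,E} over non-isomorphic fields. *)

theory Defs
  imports Complex_Main "HOL-Algebra.Complete_Lattice"
begin

text \<open>
  \<^class>\<open>division_ring\<close> does not assume commutativity, while the locales
  \<^locale>\<open>module\<close> and \<^locale>\<open>vector_space\<close> do.  Hence the following locales.
  A vector space is modelled by a whole type.
\<close>

locale left_vector_space =
  fixes lscale :: "'k::division_ring \<Rightarrow> 'e::ab_group_add \<Rightarrow> 'e"
  assumes lscale_add_right: "lscale a (x + y) = lscale a x + lscale a y"
    and lscale_add_left: "lscale (a + b) x = lscale a x + lscale b x"
    and lscale_lscale: "lscale a (lscale b x) = lscale (a * b) x"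
    and lscale_one: "lscale 1 x = x"

locale right_vector_space =
  fixes rscale :: "'f::ab_group_add \<Rightarrow> 'k::division_ring \<Rightarrow> 'f"
  assumes rscale_add_left: "rscale (y + z) a = rscale y a + rscale z a"
    and rscale_add_right: "rscale y (a + b) = rscale y a + rscale y b"
    and rscale_rscale: "rscale (rscale y a) b = rscale y (a * b)"
    and rscale_one: "rscale y 1 = y"

locale dual_pair = left_vector_space lscale + right_vector_space rscale
  for lscale :: "'k::division_ring \<Rightarrow> 'e::ab_group_add \<Rightarrow> 'e"
    and rscale :: "'f::ab_group_add \<Rightarrow> 'k \<Rightarrow> 'f" +
  fixes B :: "'e \<Rightarrow> 'f \<Rightarrow> 'k"
  assumes form_add_left: "B (x + x') y = B x y + B x' y"
    and form_add_right: "B x (y + y') = B x y + B x y'"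
    and form_lscale: "B (lscale a x) y = a * B x y"
    and form_rscale: "B x (rscale y a) = B x y * a"
    and nondegenerate_left: "(\<And>y. B x y = 0) \<Longrightarrow> x = 0"
    and nondegenerate_right: "(\<And>x. B x y = 0) \<Longrightarrow> y = 0"

definition left_subspace :: "('k::division_ring \<Rightarrow> 'e::ab_group_add \<Rightarrow> 'e) \<Rightarrow> 'e set \<Rightarrow> bool"
  where "left_subspace lscale A \<longleftrightarrow>
    0 \<in> A \<and> (\<forall>x\<in>A. \<forall>y\<in>A. x + y \<in> A) \<and> (\<forall>a. \<forall>x\<in>A. lscale a x \<in> A)"

definition left_independent :: "('k::division_ring \<Rightarrow> 'e::ab_group_add \<Rightarrow> 'e) \<Rightarrow> 'e set \<Rightarrow> bool"
  where "left_independent lscale S \<longleftrightarrow>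
    (\<forall>T u. finite T \<longrightarrow> T \<subseteq> S \<longrightarrow> (\<Sum>x\<in>T. lscale (u x) x) = 0 \<longrightarrow> (\<forall>x\<in>T. u x = 0))"

definition perp_of_left :: "('e \<Rightarrow> 'f \<Rightarrow> 'k::zero) \<Rightarrow> 'e set \<Rightarrow> 'f set"
  where "perp_of_left B A = {y. \<forall>x\<in>A. B x y = 0}"

definition perp_of_right :: "('e \<Rightarrow> 'f \<Rightarrow> 'k::zero) \<Rightarrow> 'f set \<Rightarrow> 'e set"
  where "perp_of_right B C = {x. \<forall>y\<in>C. B x y = 0}"

definition F_closed ::
    "('k::division_ring \<Rightarrow> 'e::ab_group_add \<Rightarrow> 'e) \<Rightarrow> ('e \<Rightarrow> 'f \<Rightarrow> 'k) \<Rightarrow> 'e set \<Rightarrow> bool"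
  where "F_closed lscale B A \<longleftrightarrow>
    left_subspace lscale A \<and> A = perp_of_right B (perp_of_left B A)"

definition closed_lattice ::
    "('k::division_ring \<Rightarrow> 'e::ab_group_add \<Rightarrow> 'e) \<Rightarrow> ('e \<Rightarrow> 'f \<Rightarrow> 'k) \<Rightarrow> 'e set gorder"
  where "closed_lattice lscale B =
    \<lparr>carrier = {A. F_closed lscale B A}, eq = (=), le = (\<subseteq>)\<rparr>"

lemma complete_lattice_closed_lattice:
  "complete_lattice (closed_lattice lscale B)" (is "complete_lattice ?L")
proof (rule partial_order.complete_lattice_criterion1)
  show "partial_order ?L"
    by standard (auto simp: closed_lattice_def)
  have "F_closed lscale B UNIV"
    by (auto simp: F_closed_def left_subspace_def perp_of_left_def perp_of_right_def)
  then have "greatest ?L UNIV (carrier ?L)"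
    by (simp add: closed_lattice_def greatest_def)
  then show "\<exists>g. greatest ?L g (carrier ?L)" ..
next
  fix \<A> assume "\<A> \<subseteq> carrier ?L"
  then have cl: "left_subspace lscale A" "A = perp_of_right B (perp_of_left B A)" if "A \<in> \<A>" for A
    using that by (auto simp: closed_lattice_def F_closed_def)
  have "perp_of_right B (perp_of_left B (\<Inter>\<A>)) \<subseteq> A" if "A \<in> \<A>" for A
    using that by (subst (2) cl(2)) (auto simp: perp_of_left_def perp_of_right_def)
  moreover have "\<Inter>\<A> \<subseteq> perp_of_right B (perp_of_left B (\<Inter>\<A>))"
    by (auto simp: perp_of_left_def perp_of_right_def)
  ultimately have "\<Inter>\<A> = perp_of_right B (perp_of_left B (\<Inter>\<A>))"
    by blast
  moreover have "left_subspace lscale (\<Inter>\<A>)"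
    using cl(1) by (simp add: left_subspace_def)
  ultimately have "greatest ?L (\<Inter>\<A>) (Lower ?L \<A>)"
    using cl unfolding greatest_def Lower_def closed_lattice_def F_closed_def
    by (simp add: Inf_greatest) (blast intro: Inf_greatest)
  then show "\<exists>i. greatest ?L i (Lower ?L \<A>)" ..
qed

definition lattice_isomorphism :: "'a gorder \<Rightarrow> 'b gorder \<Rightarrow> ('a \<Rightarrow> 'b) \<Rightarrow> bool"
  where "lattice_isomorphism L M \<psi> \<longleftrightarrow>
    bij_betw \<psi> (carrier L) (carrier M) \<and>
    (\<forall>x\<in>carrier L. \<forall>y\<in>carrier L. \<psi> (x \<squnion>\<^bsub>L\<^esub> y) = \<psi> x \<squnion>\<^bsub>M\<^esub> \<psi> y) \<and>
    (\<forall>x\<in>carrier L. \<forall>y\<in>carrier L. \<psi> (x \<sqinter>\<^bsub>L\<^esub> y) = \<psi> x \<sqinter>\<^bsub>M\<^esub> \<psi> y)"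

definition field_isomorphism :: "('k1::division_ring \<Rightarrow> 'k2::division_ring) \<Rightarrow> bool"
  where "field_isomorphism \<sigma> \<longleftrightarrow>
    bij \<sigma> \<and> (\<forall>a b. \<sigma> (a + b) = \<sigma> a + \<sigma> b) \<and> (\<forall>a b. \<sigma> (a * b) = \<sigma> a * \<sigma> b) \<and> \<sigma> 1 = 1"

definition semi_linear ::
    "('k1::division_ring \<Rightarrow> 'e1::ab_group_add \<Rightarrow> 'e1) \<Rightarrow>
     ('k2::division_ring \<Rightarrow> 'e2::ab_group_add \<Rightarrow> 'e2) \<Rightarrow> ('e1 \<Rightarrow> 'e2) \<Rightarrow> bool"
  where "semi_linear lscale1 lscale2 s \<longleftrightarrow>
    additive s \<and>
    (\<exists>\<sigma>. field_isomorphism \<sigma> \<and> (\<forall>a x. s (lscale1 a x) = lscale2 (\<sigma> a) (s x)))"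

end

theory Submission
  imports Defs
begin

text \<open>
  The theorem is the fundamental theorem of projective geometry, transported to the lattice of
  closed subspaces.  Adding one vector to a closed subspace gives a closed subspace
  (\<open>closed_add_vector\<close>), so every set \<open>Kx + Ky\<close> is closed; it is then the least closed subspace
  containing \<open>x\<close> and \<open>y\<close>.  Hence an order isomorphism \<open>\<psi>\<close> of the lattices determines which point
  of \<open>E2\<close> belongs to which point of \<open>E1\<close>, and this correspondence preserves and reflects
  collinearity.  For vectors it is convenient to use the relation "\<open>x \<in> M\<close> if and only if
  \<open>x' \<in> \<psi> M\<close>, for all closed \<open>M\<close>" (\<open>corresponding\<close>): it says that \<open>x\<close> and \<open>x'\<close> span matching
  points, or both vanish, and it treats the two sides symmetrically.

  A vector \<open>x'\<close> that corresponds to \<open>x\<close> is determined up to a scalar only, and the task is to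
  choose the scalars coherently.  If \<open>x, y\<close> are independent and \<open>x'\<close> is chosen, then
  exactly one \<open>y'\<close> corresponding to \<open>y\<close> makes \<open>x' - y'\<close> correspond to \<open>x - y\<close>
  (\<open>ex_linked\<close>, \<open>linked_unique\<close>).  If this rule leads from \<open>x'\<close> to \<open>y'\<close> and to \<open>z'\<close>, with
  \<open>x, y, z\<close> independent, then it also leads from \<open>y'\<close> to \<open>z'\<close> (\<open>linked_triangle\<close>): the point of
  \<open>y - z\<close> is the intersection of the lines through the points of \<open>y, z\<close> and of
  \<open>x - y, x - z\<close>.  This is where dimension at least three enters.  Propagating one choice along
  such triangles gives a coherent choice \<open>s\<close> (\<open>ex_linked_section\<close>).

  The map \<open>s\<close> is the semi-linear map sought.  For independent \<open>x, y\<close>, coherence puts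
  \<open>s (x + y)\<close> into both \<open>s x + K (s y)\<close> and \<open>s y + K (s x)\<close>, whose only common element is
  \<open>s x + s y\<close>; dependent pairs follow by adding a third vector.  Since \<open>s (a x)\<close> is a multiple of
  \<open>s x\<close>, additivity forces the multiplier to depend on \<open>a\<close> alone, and the multiplier is the field
  isomorphism.  Finally \<open>x \<in> M\<close> if and only if \<open>s x \<in> \<psi> M\<close>, which for bijective \<open>s\<close> is
  \<open>\<psi> M = s ` M\<close>.
\<close>

section \<open>Subspaces spanned by two vectors over a division ring\<close>

context left_vector_space
begin

lemma lscale_zero_left [simp]: "lscale 0 x = 0"
  using lscale_add_left[of 0 0 x] by simp

lemma lscale_zero_right [simp]: "lscale a 0 = 0"
  using lscale_add_right[of a 0 0] by simp

lemma lscale_minus_left: "lscale (- a) x = - lscale a x"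
  using lscale_add_left[of a "- a" x] by (simp add: add_eq_0_iff)

lemma lscale_minus_right: "lscale a (- x) = - lscale a x"
  using lscale_add_right[of a x "- x"] by (simp add: add_eq_0_iff)

lemma lscale_diff_left: "lscale (a - b) x = lscale a x - lscale b x"
  using lscale_add_left[of a "- b" x] by (simp add: lscale_minus_left)

lemma lscale_diff_right: "lscale a (x - y) = lscale a x - lscale a y"
  using lscale_add_right[of a x "- y"] by (simp add: lscale_minus_right)

lemmas lscale_distribs = lscale_add_left lscale_add_right lscale_minus_left lscale_minus_right
  lscale_diff_left lscale_diff_right

lemma lscale_eq_0_iff [simp]: "lscale a x = 0 \<longleftrightarrow> a = 0 \<or> x = 0"
proof -
  have "x = 0" if "lscale a x = 0" "a \<noteq> 0"
  proof -
    have "x = lscale (inverse a) (lscale a x)"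
      using that(2) by (simp add: lscale_lscale lscale_one del: lscale_zero_right)
    then show ?thesis using that(1) by simp
  qed
  then show ?thesis by auto
qed

text \<open>
  The span of two vectors; \<open>x\<close> and \<open>y\<close> may be dependent, so that \<open>plane x 0\<close> is the line of \<open>x\<close>.
\<close>

definition plane :: "'e \<Rightarrow> 'e \<Rightarrow> 'e set"
  where "plane x y = {lscale a x + lscale b y |a b. True}"

text \<open>
  Independence of families rather than of sets: a repeated vector makes the family dependent.
\<close>

definition indep2 :: "'e \<Rightarrow> 'e \<Rightarrow> bool"
  where "indep2 x y \<longleftrightarrow> (\<forall>a b. lscale a x + lscale b y = 0 \<longrightarrow> a = 0 \<and> b = 0)"

definition indep3 :: "'e \<Rightarrow> 'e \<Rightarrow> 'e \<Rightarrow> bool"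
  where "indep3 x y z \<longleftrightarrow>
    (\<forall>a b c. lscale a x + lscale b y + lscale c z = 0 \<longrightarrow> a = 0 \<and> b = 0 \<and> c = 0)"

lemma in_plane_iff: "z \<in> plane x y \<longleftrightarrow> (\<exists>a b. z = lscale a x + lscale b y)"
  by (auto simp: plane_def)

lemma in_plane: "lscale a x + lscale b y \<in> plane x y"
  by (auto simp: in_plane_iff)

lemma in_plane_0_iff: "z \<in> plane x 0 \<longleftrightarrow> (\<exists>a. z = lscale a x)"
  by (auto simp: in_plane_iff)

lemma left_subspace_plane: "left_subspace lscale (plane x y)"
proof -
  have "lscale a x + lscale b y + (lscale c x + lscale d y) = lscale (a + c) x + lscale (b + d) y"
    for a b c d by (simp add: lscale_distribs)
  moreover have "lscale c (lscale a x + lscale b y) = lscale (c * a) x + lscale (c * b) y"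
    for a b c by (simp add: lscale_distribs lscale_lscale)
  moreover have "0 = lscale 0 x + lscale 0 y" by simp
  ultimately show ?thesis
    unfolding left_subspace_def plane_def by blast
qed

lemma plane_least:
  assumes "left_subspace lscale A" "x \<in> A" "y \<in> A"
  shows "plane x y \<subseteq> A"
  using assms by (auto simp: left_subspace_def plane_def)

lemma fst_in_plane: "x \<in> plane x y" and snd_in_plane: "y \<in> plane x y"
  using in_plane[of 1 x 0 y] in_plane[of 0 x 1 y] by (simp_all add: lscale_one)

lemma zero_in_plane: "0 \<in> plane x y"
  using left_subspace_plane by (simp add: left_subspace_def)

lemma plane_commute: "plane x y = plane y x"
  by (intro equalityI plane_least left_subspace_plane fst_in_plane snd_in_plane)

lemma plane_mono:
  assumes "x \<in> plane u v" "y \<in> plane u v"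
  shows "plane x y \<subseteq> plane u v"
  using assms by (intro plane_least left_subspace_plane)

lemma line_minimal:
  assumes "left_subspace lscale N" "N \<subseteq> plane x 0" "N \<noteq> {0}"
  shows "N = plane x 0"
proof
  obtain u where u: "u \<in> N" "u \<noteq> 0" using assms by (auto simp: left_subspace_def)
  then obtain a where a: "u = lscale a x" using assms(2) in_plane_0_iff by blast
  with u have "a \<noteq> 0" by auto
  then have "lscale (inverse a) u = x" by (simp add: a lscale_lscale lscale_one)
  then have "x \<in> N" using assms(1) u by (auto simp: left_subspace_def)
  then show "plane x 0 \<subseteq> N" using assms(1) by (intro plane_least) (auto simp: left_subspace_def)
qed (fact assms(2))

lemma solve_in_plane:
  assumes "lscale a x + lscale b y + lscale c z = 0" "c \<noteq> 0"
  shows "z \<in> plane x y"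
proof -
  have "lscale c z = - (lscale a x + lscale b y)"
    using assms(1) by (simp add: add_eq_0_iff)
  then have "lscale (inverse c) (lscale c z) =
      lscale (- (inverse c * a)) x + lscale (- (inverse c * b)) y"
    by (simp add: lscale_distribs lscale_lscale)
  then have "z = lscale (- (inverse c * a)) x + lscale (- (inverse c * b)) y"
    using assms(2) by (simp add: lscale_lscale lscale_one)
  then show ?thesis by (auto simp: in_plane_iff)
qed

lemma indep2_iff_plane: "indep2 x y \<longleftrightarrow> x \<noteq> 0 \<and> y \<notin> plane x 0"
proof
  assume ind: "indep2 x y"
  have "x \<noteq> 0"
    using ind[unfolded indep2_def, rule_format, of 1 0] by auto
  moreover have False if "y = lscale a x" for a
    using ind[unfolded indep2_def, rule_format, of "- a" 1] that
    by (simp add: lscale_minus_left lscale_one)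
  ultimately show "x \<noteq> 0 \<and> y \<notin> plane x 0"
    by (auto simp: in_plane_0_iff)
next
  assume *: "x \<noteq> 0 \<and> y \<notin> plane x 0"
  show "indep2 x y" unfolding indep2_def
  proof (intro allI impI)
    fix a b assume eq: "lscale a x + lscale b y = 0"
    then have "b = 0" using solve_in_plane[of a x 0 0 b y] * by auto
    with eq * show "a = 0 \<and> b = 0" by simp
  qed
qed

lemma not_indep2D: "\<not> indep2 x y \<Longrightarrow> x \<noteq> 0 \<Longrightarrow> \<exists>a. y = lscale a x"
  by (auto simp: indep2_iff_plane in_plane_0_iff)

lemma indep3_iff_plane: "indep3 x y z \<longleftrightarrow> indep2 x y \<and> z \<notin> plane x y"
proof
  assume ind: "indep3 x y z"
  have "indep2 x y" unfolding indep2_def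
    using ind[unfolded indep3_def, rule_format, of _ _ 0] by auto
  moreover have False if "z = lscale a x + lscale b y" for a b
    using ind[unfolded indep3_def, rule_format, of "- a" "- b" 1] that
    by (simp add: lscale_minus_left lscale_one)
  ultimately show "indep2 x y \<and> z \<notin> plane x y"
    by (auto simp: in_plane_iff)
next
  assume *: "indep2 x y \<and> z \<notin> plane x y"
  show "indep3 x y z" unfolding indep3_def
  proof (intro allI impI)
    fix a b c assume eq: "lscale a x + lscale b y + lscale c z = 0"
    then have "c = 0" using solve_in_plane[of a x b y c z] * by auto
    with eq * show "a = 0 \<and> b = 0 \<and> c = 0" by (auto simp: indep2_def)
  qed
qed

lemma indep2_commute: "indep2 x y \<longleftrightarrow> indep2 y x"
proof -
  have "lscale b y + lscale a x = lscale a x + lscale b y" for a b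
    by (rule add.commute)
  then show ?thesis unfolding indep2_def by metis
qed

lemma indep3_rotate: "indep3 x y z \<longleftrightarrow> indep3 y z x"
proof -
  have "lscale b y + lscale c z + lscale a x = lscale a x + lscale b y + lscale c z" for a b c
    by (simp add: ac_simps)
  then show ?thesis unfolding indep3_def by metis
qed

lemma indep3D:
  assumes "indep3 x y z"
  shows "indep2 x y" "indep2 x z" "indep2 y z"
proof -
  have yzx: "indep3 y z x" using assms indep3_rotate[of x y z] by blast
  then have "indep3 z x y" using indep3_rotate[of y z x] by blast
  then show "indep2 x y" "indep2 x z" "indep2 y z"
    using assms yzx indep2_commute[of x z] by (simp_all add: indep3_iff_plane)
qed

lemma indep2_coeffs_eq:
  assumes "indep2 x y" "lscale a x + lscale b y = lscale c x + lscale d y"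
  shows "a = c" "b = d"
proof -
  have "lscale (a - c) x + lscale (b - d) y = 0"
    using assms(2) by (simp add: lscale_distribs algebra_simps)
  then have "a - c = 0" "b - d = 0" using assms(1) unfolding indep2_def by blast+
  then show "a = c" "b = d" by simp_all
qed

lemma indep2_comb:
  assumes "indep2 x y" "b \<noteq> 0"
  shows "indep2 x (lscale a x + lscale b y)"
  unfolding indep2_def
proof (intro allI impI)
  fix c d assume "lscale c x + lscale d (lscale a x + lscale b y) = 0"
  then have "lscale (c + d * a) x + lscale (d * b) y = 0"
    by (simp add: lscale_distribs lscale_lscale algebra_simps)
  then have "c + d * a = 0" "d * b = 0" using assms(1) unfolding indep2_def by blast+
  then show "c = 0 \<and> d = 0" using assms(2) by auto
qed

lemma indep2_add: "indep2 x y \<Longrightarrow> indep2 x (x + y)"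
  and indep2_diff: "indep2 x y \<Longrightarrow> indep2 x (x - y)"
  using indep2_comb[of x y 1 1] indep2_comb[of x y "- 1" 1]
  by (simp_all add: lscale_minus_left lscale_one)

lemma plane_exchange:
  assumes "z \<in> plane x y" "indep2 x z"
  shows "plane x y \<subseteq> plane x z"
proof -
  obtain a b where z: "z = lscale a x + lscale b y" using assms(1) by (auto simp: in_plane_iff)
  have "b \<noteq> 0" using assms(2) z by (auto simp: indep2_iff_plane in_plane_0_iff)
  moreover have "lscale a x + lscale (- 1) z + lscale b y = 0"
    using z by (simp add: lscale_minus_left lscale_one)
  ultimately have "y \<in> plane x z" by (rule solve_in_plane[rotated])
  then show ?thesis by (intro plane_mono fst_in_plane)
qed

text \<open>
  The Steinitz exchange for two vectors: \<open>u\<close> replaces one of \<open>x, y\<close>, and then \<open>v\<close> replaces the other.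
\<close>

lemma plane_eq_of_indep2:
  assumes "u \<in> plane x y" "v \<in> plane x y" "indep2 u v"
  shows "plane u v = plane x y"
proof
  show "plane u v \<subseteq> plane x y" using assms by (intro plane_mono)
  have u0: "u \<noteq> 0" using assms(3) by (simp add: indep2_iff_plane)
  obtain a b where u: "u = lscale a x + lscale b y" using assms(1) by (auto simp: in_plane_iff)
  obtain w where w: "plane x y \<subseteq> plane u w"
  proof (cases "b = 0")
    case False
    then have "y \<in> plane x u"
      using solve_in_plane[of a x "- 1" u b y] u by (simp add: lscale_minus_left lscale_one)
    then have "plane x y \<subseteq> plane u x"
      by (subst plane_commute[of u]) (intro plane_mono fst_in_plane)
    then show ?thesis by (rule that)
  next
    case True
    then have "a \<noteq> 0" using u u0 by auto
    then have "x \<in> plane y u"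
      using solve_in_plane[of b y "- 1" u a x] u
      by (simp add: lscale_minus_left lscale_one algebra_simps)
    then have "plane x y \<subseteq> plane u y"
      by (subst plane_commute[of u]) (intro plane_mono fst_in_plane)
    then show ?thesis by (rule that)
  qed
  then have "plane u w \<subseteq> plane u v"
    using assms by (intro plane_exchange) auto
  with w show "plane x y \<subseteq> plane u v" by simp
qed

text \<open>
  Three independent vectors cannot all lie in a plane, since two of them would already span it.
\<close>

lemma ex_not_in_plane:
  assumes "card S = 3" "left_independent lscale S"
  shows "\<exists>z. z \<notin> plane x y"
proof -
  obtain u v w where S: "S = {u, v, w}" and ne: "u \<noteq> v" "u \<noteq> w" "v \<noteq> w"
    using assms(1) by (auto simp: card_3_iff)
  have "indep3 u v w" unfolding indep3_def
  proof (intro allI impI)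
    fix a b c assume eq: "lscale a u + lscale b v + lscale c w = 0"
    define k where "k t = (if t = u then a else if t = v then b else c)" for t
    have "(\<Sum>t\<in>S. lscale (k t) t) = 0"
      using eq ne by (simp add: S k_def add.assoc)
    then have "\<forall>t\<in>S. k t = 0"
      using assms(2)[unfolded left_independent_def, rule_format, of S k] S by simp
    then show "a = 0 \<and> b = 0 \<and> c = 0" using ne by (auto simp: S k_def)
  qed
  then have "indep2 u v" "w \<notin> plane u v" by (auto simp: indep3_iff_plane)
  then show ?thesis using plane_eq_of_indep2[of u x y v] by metis
qed

end

section \<open>Closed subspaces of a dual pair\<close>

context dual_pair
begin

abbreviation ortho_closed :: "'e set \<Rightarrow> bool"
  where "ortho_closed A \<equiv> F_closed lscale B A"

lemma form_zero_left [simp]: "B 0 y = 0"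
  using form_add_left[of 0 0 y] by simp

lemma form_diff_left: "B (x - x') y = B x y - B x' y"
  using form_add_left[of "x - x'" x' y] by (simp add: algebra_simps)

lemma form_diff_right: "B x (y - y') = B x y - B x y'"
  using form_add_right[of x "y - y'" y'] by (simp add: algebra_simps)

lemma closed_iff:
  "ortho_closed A \<longleftrightarrow> left_subspace lscale A \<and>
    (\<forall>z. z \<notin> A \<longrightarrow> (\<exists>f. (\<forall>x\<in>A. B x f = 0) \<and> B z f \<noteq> 0))"
  unfolding F_closed_def perp_of_left_def perp_of_right_def by blast

lemma closed_zero: "ortho_closed {0}"
  using nondegenerate_left by (auto simp: closed_iff left_subspace_def)

text \<open>
  If \<open>x \<notin> A\<close>, some \<open>f\<close> annihilates \<open>A\<close> and has \<open>B x f = 1\<close>.  Then \<open>z \<mapsto> z - (B z f) x\<close> projects along \<open>x\<close>.  A vector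
  outside \<open>A + K x\<close> is projected outside \<open>A\<close>, so some \<open>g\<close> annihilating \<open>A\<close> detects its projection;
  the composite of \<open>g\<close> with the projection is again given by an element of \<open>F\<close>, namely
  \<open>g - f (B x g)\<close>, and it annihilates \<open>x\<close> too.
\<close>

lemma closed_add_vector:
  assumes "ortho_closed A"
  shows "ortho_closed {z. \<exists>a. z - lscale a x \<in> A}" (is "ortho_closed ?C")
proof -
  have sub: "left_subspace lscale A"
    using assms by (simp add: closed_iff)
  have sep: "\<exists>f. (\<forall>x\<in>A. B x f = 0) \<and> B z f \<noteq> 0" if "z \<notin> A" for z
    using assms that by (simp add: closed_iff)
  have add: "u + v \<in> A" and scale: "lscale c u \<in> A" if "u \<in> A" "v \<in> A" for u v c
    using sub that by (auto simp: left_subspace_def)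
  have "left_subspace lscale ?C" unfolding left_subspace_def
  proof (intro conjI ballI allI)
    have "0 - lscale 0 x \<in> A" using sub by (simp add: left_subspace_def)
    then show "0 \<in> ?C" by blast
  next
    fix u v assume "u \<in> ?C" "v \<in> ?C"
    then obtain a b where "u - lscale a x \<in> A" "v - lscale b x \<in> A" by auto
    from add[OF this] have "u + v - lscale (a + b) x \<in> A"
      by (simp add: lscale_distribs algebra_simps)
    then show "u + v \<in> ?C" by blast
  next
    fix c u assume "u \<in> ?C"
    then obtain a where "u - lscale a x \<in> A" by auto
    from scale[OF this this, of c] have "lscale c u - lscale (c * a) x \<in> A"
      by (simp add: lscale_distribs lscale_lscale)
    then show "lscale c u \<in> ?C" by blast
  qed
  moreover have "\<exists>f. (\<forall>u\<in>?C. B u f = 0) \<and> B z f \<noteq> 0" if "z \<notin> ?C" for z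
  proof -
    have kill: "B u h = 0" if "\<forall>v\<in>A. B v h = 0" "B x h = 0" "u \<in> ?C" for u h
    proof -
      obtain a where "u - lscale a x \<in> A" using \<open>u \<in> ?C\<close> by auto
      then have "B (u - lscale a x) h = 0" using that(1) by blast
      then show ?thesis using that(2) by (simp add: form_diff_left form_lscale)
    qed
    have z: "z - lscale a x \<notin> A" for a using that by auto
    show ?thesis
    proof (cases "x \<in> A")
      case True
      obtain f where "\<forall>v\<in>A. B v f = 0" "B z f \<noteq> 0" using sep z[of 0] by auto
      then show ?thesis using True kill by blast
    next
      case False
      obtain f where f: "\<forall>v\<in>A. B v f = 0" "B x f \<noteq> 0" using sep[OF False] by auto
      \<comment> \<open>Right multiplication normalises \<open>f\<close> so that \<open>B x f1 = 1\<close>.\<close>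
      define f1 where "f1 = rscale f (inverse (B x f))"
      have f1: "\<forall>v\<in>A. B v f1 = 0" "B x f1 = 1"
        using f by (simp_all add: f1_def form_rscale)
      obtain g where g: "\<forall>v\<in>A. B v g = 0" "B (z - lscale (B z f1) x) g \<noteq> 0"
        using sep[OF z] by blast
      define h where "h = g - rscale f1 (B x g)"
      have "\<forall>v\<in>A. B v h = 0" "B x h = 0"
        using f1 g(1) by (simp_all add: h_def form_diff_right form_rscale)
      moreover have "B z h \<noteq> 0"
        using g(2) by (simp add: h_def form_diff_left form_diff_right form_rscale form_lscale)
      ultimately show ?thesis using kill by blast
    qed
  qed
  ultimately show ?thesis unfolding closed_iff by blast
qed

lemma closed_plane: "ortho_closed (plane x y)"
proof -
  have "plane x y = {z. \<exists>b. z - lscale b y \<in> {z. \<exists>a. z - lscale a x \<in> {0}}}"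
  proof -
    have "z = lscale a x + lscale b y \<longleftrightarrow> z - lscale b y - lscale a x = 0" for z a b
      by (auto simp: algebra_simps)
    then show ?thesis unfolding plane_def by blast
  qed
  then show ?thesis
    using closed_add_vector[OF closed_add_vector[OF closed_zero]] by simp
qed

text \<open>
  Spans of two vectors are described by the lattice alone; this is how a lattice isomorphism
  comes to preserve collinearity.
\<close>

lemma in_plane_iff_closed:
  "z \<in> plane x y \<longleftrightarrow> (\<forall>M. ortho_closed M \<longrightarrow> x \<in> M \<longrightarrow> y \<in> M \<longrightarrow> z \<in> M)"
proof
  assume "z \<in> plane x y"
  then show "\<forall>M. ortho_closed M \<longrightarrow> x \<in> M \<longrightarrow> y \<in> M \<longrightarrow> z \<in> M"
    using plane_least by (auto simp: F_closed_def)
qed (use closed_plane fst_in_plane snd_in_plane in blast)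

lemma closed_scale_iff:
  assumes "ortho_closed M" "c \<noteq> 0"
  shows "lscale c x \<in> M \<longleftrightarrow> x \<in> M"
proof
  assume "lscale c x \<in> M"
  then have "lscale (inverse c) (lscale c x) \<in> M"
    using assms(1) by (auto simp: F_closed_def left_subspace_def)
  then show "x \<in> M" using assms(2) by (simp add: lscale_lscale lscale_one)
qed (use assms in \<open>auto simp: F_closed_def left_subspace_def\<close>)

end

section \<open>Coherent choice of representatives for a collineation\<close>

text \<open>
  A collineation between projective spaces, seen as a relation between vectors: \<open>rep x x'\<close> means
  that the points of \<open>x\<close> and \<open>x'\<close> match.  The zero vectors are included, so that
  collinearity, equality of points and vanishing all become instances of \<open>rep_plane\<close>.
\<close>

locale projective_correspondence =
  E1: left_vector_space scale1 + E2: left_vector_space scale2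
  for scale1 :: "'k1::division_ring \<Rightarrow> 'e1::ab_group_add \<Rightarrow> 'e1"
    and scale2 :: "'k2::division_ring \<Rightarrow> 'e2::ab_group_add \<Rightarrow> 'e2" +
  fixes rep :: "'e1 \<Rightarrow> 'e2 \<Rightarrow> bool"
  assumes rep_left_total: "\<exists>x'. rep x x'"
    and rep_right_total: "\<exists>x. rep x x'"
    and rep_scale: "rep x x' \<Longrightarrow> a \<noteq> 0 \<Longrightarrow> b \<noteq> 0 \<Longrightarrow> rep (scale1 a x) (scale2 b x')"
    and rep_plane: "rep x x' \<Longrightarrow> rep y y' \<Longrightarrow> rep z z' \<Longrightarrow>
      z \<in> E1.plane x y \<longleftrightarrow> z' \<in> E2.plane x' y'"
    and ex_not_in_plane: "\<exists>z. z \<notin> E1.plane x y"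
begin

lemma rep_scale2: "rep x x' \<Longrightarrow> b \<noteq> 0 \<Longrightarrow> rep x (scale2 b x')"
  using rep_scale[of x x' 1 b] by (simp add: E1.lscale_one)

lemma rep_scale1: "rep x x' \<Longrightarrow> a \<noteq> 0 \<Longrightarrow> rep (scale1 a x) x'"
  using rep_scale[of x x' a 1] by (simp add: E2.lscale_one)

lemma rep_minus: "rep x x' \<Longrightarrow> rep (- x) (- x')"
  using rep_scale[of x x' "- 1" "- 1"]
  by (simp add: E1.lscale_one E1.lscale_minus_left E2.lscale_one E2.lscale_minus_left)

lemma rep_0_0: "rep 0 0"
proof -
  obtain x where x: "rep x 0" using rep_right_total by blast
  obtain u where u: "rep 0 u" using rep_left_total by blast
  have "0 \<in> E2.plane u u" using E2.left_subspace_plane by (auto simp: left_subspace_def)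
  then have "x \<in> E1.plane 0 0" using rep_plane[OF u u x] by simp
  then show ?thesis using x by (auto simp: E1.in_plane_0_iff)
qed

lemma rep_unique:
  assumes "rep x x'" "rep x x''"
  shows "\<exists>c. x'' = scale2 c x'"
  using rep_plane[OF assms(1) rep_0_0 assms(2)] E1.fst_in_plane E2.in_plane_0_iff by auto

lemma rep_0_iff: "rep x x' \<Longrightarrow> x = 0 \<longleftrightarrow> x' = 0"
  using rep_plane[OF rep_0_0 rep_0_0, of x x'] by (simp add: E1.in_plane_0_iff E2.in_plane_0_iff)

lemma rep_indep2: "rep x x' \<Longrightarrow> rep y y' \<Longrightarrow> E1.indep2 x y \<longleftrightarrow> E2.indep2 x' y'"
  using rep_plane[OF _ rep_0_0] rep_0_iff
  unfolding E1.indep2_iff_plane E2.indep2_iff_plane by blast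

lemma rep_indep3:
  "rep x x' \<Longrightarrow> rep y y' \<Longrightarrow> rep z z' \<Longrightarrow> E1.indep3 x y z \<longleftrightarrow> E2.indep3 x' y' z'"
  using rep_plane rep_indep2
  unfolding E1.indep3_iff_plane E2.indep3_iff_plane by blast

text \<open>
  The representatives \<open>x'\<close> and \<open>y'\<close> are scaled compatibly, as the values of a linear map
  matching the correspondence would be.
\<close>

definition linked :: "'e1 \<Rightarrow> 'e2 \<Rightarrow> 'e1 \<Rightarrow> 'e2 \<Rightarrow> bool"
  where "linked x x' y y' \<longleftrightarrow> rep x x' \<and> rep y y' \<and> rep (x - y) (x' - y')"

lemma linked_sym: "linked x x' y y' \<Longrightarrow> linked y y' x x'"
  using rep_minus[of "x - y" "x' - y'"] by (simp add: linked_def)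

text \<open>
  A vector \<open>w\<close> corresponding to \<open>x - y\<close> is a combination of \<open>x'\<close> and of any representative of \<open>y\<close>, with
  both coefficients nonzero; rescaling makes it \<open>x' - y'\<close>.
\<close>

lemma ex_linked:
  assumes "rep x x'" "E1.indep2 x y"
  shows "\<exists>y'. linked x x' y y'"
proof -
  obtain y0 where y0: "rep y y0" using rep_left_total by blast
  obtain w where w: "rep (x - y) w" using rep_left_total by blast
  have ind: "E1.indep2 x (x - y)" "E1.indep2 y (x - y)"
    using E1.indep2_diff[OF assms(2)] E1.indep2_comb[of y x 1 "- 1"] assms(2)
    by (simp_all add: E1.indep2_commute[of y] E1.lscale_one E1.lscale_minus_left)
  have "x - y \<in> E1.plane x y"
    using E1.in_plane[of 1 x "- 1" y] by (simp add: E1.lscale_one E1.lscale_minus_left)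
  then have "w \<in> E2.plane x' y0" using rep_plane[OF assms(1) y0 w] by simp
  then obtain a b where ab: "w = scale2 a x' + scale2 b y0" by (auto simp: E2.in_plane_iff)
  have "E2.indep2 x' w" "E2.indep2 y0 w"
    using ind rep_indep2 assms(1) y0 w by blast+
  then have nz: "a \<noteq> 0" "b \<noteq> 0"
    using ab by (auto simp: E2.indep2_iff_plane E2.in_plane_0_iff)
  define y' where "y' = scale2 (- (inverse a * b)) y0"
  have "x' - y' = scale2 (inverse a) w"
    using nz by (simp add: y'_def ab E2.lscale_distribs E2.lscale_lscale E2.lscale_one)
  moreover have "rep (x - y) (scale2 (inverse a) w)" "rep y y'"
    unfolding y'_def using nz by (intro rep_scale2 w y0; simp)+
  ultimately show ?thesis using assms(1) by (auto simp: linked_def)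
qed

lemma linked_unique:
  assumes "linked x x' y y'" "linked x x' y y''" "E1.indep2 x y"
  shows "y' = y''"
proof -
  have reps: "rep x x'" "rep y y'" "rep y y''" "rep (x - y) (x' - y')" "rep (x - y) (x' - y'')"
    using assms by (simp_all add: linked_def)
  obtain c where c: "y'' = scale2 c y'" using rep_unique reps by blast
  obtain d where d: "x' - y'' = scale2 d (x' - y')" using rep_unique reps by blast
  have "E2.indep2 x' y'" using rep_indep2 reps assms(3) by blast
  moreover have "scale2 1 x' + scale2 (- c) y' = scale2 d x' + scale2 (- d) y'"
    using c d by (simp add: E2.lscale_distribs E2.lscale_one)
  ultimately have "1 = d" "- c = - d" using E2.indep2_coeffs_eq by blast+
  then show ?thesis using c by (simp add: E2.lscale_one)
qed

text \<open>
  The difference \<open>y - z\<close> lies in the plane of \<open>y, z\<close> and in the plane of \<open>x - y, x - z\<close>.  On the other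
  side the corresponding planes meet only in the multiples of \<open>y' - z'\<close>, because \<open>x', y', z'\<close> are
  independent.
\<close>

lemma linked_triangle:
  assumes "linked x x' y y'" "linked x x' z z'" "E1.indep3 x y z"
  shows "linked y y' z z'"
proof -
  have reps: "rep x x'" "rep y y'" "rep z z'" "rep (x - y) (x' - y')" "rep (x - z) (x' - z')"
    using assms by (simp_all add: linked_def)
  obtain w where w: "rep (y - z) w" using rep_left_total by blast
  have ind: "E2.indep3 x' y' z'" using rep_indep3 reps assms(3) by blast
  have "y - z \<in> E1.plane y z"
    using E1.in_plane[of 1 y "- 1" z] by (simp add: E1.lscale_one E1.lscale_minus_left)
  then have "w \<in> E2.plane y' z'" using rep_plane reps w by blast
  then obtain a b where ab: "w = scale2 a y' + scale2 b z'" by (auto simp: E2.in_plane_iff)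
  have "y - z \<in> E1.plane (x - y) (x - z)"
    using E1.in_plane[of "- 1" "x - y" 1 "x - z"] by (simp add: E1.lscale_one E1.lscale_minus_left)
  then have "w \<in> E2.plane (x' - y') (x' - z')" using rep_plane reps w by blast
  then obtain c d where cd: "w = scale2 c (x' - y') + scale2 d (x' - z')"
    by (auto simp: E2.in_plane_iff)
  have "scale2 (c + d) x' + scale2 (- c - a) y' + scale2 (- d - b) z' = 0"
    using ab cd by (simp add: E2.lscale_distribs algebra_simps)
  then have "c + d = 0" "- c - a = 0" "- d - b = 0"
    using ind unfolding E2.indep3_def by blast+
  then have "b = - a" by (simp add: algebra_simps add_eq_0_iff)
  then have w_eq: "w = scale2 a (y' - z')" using ab by (simp add: E2.lscale_distribs)
  have "y \<noteq> z" using E1.indep3D(3)[OF assms(3)] by (auto simp: E1.indep2_iff_plane E1.fst_in_plane)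
  then have "a \<noteq> 0" using rep_0_iff[OF w] w_eq by auto
  then have "y' - z' = scale2 (inverse a) w"
    using w_eq by (simp add: E2.lscale_lscale E2.lscale_one)
  then have "rep (y - z) (y' - z')" using rep_scale2[OF w] \<open>a \<noteq> 0\<close> by simp
  then show ?thesis using reps by (simp add: linked_def)
qed

text \<open>
  Vectors outside the line of a fixed \<open>e\<close> are scaled against \<open>e\<close>; nonzero vectors on that line are
  scaled against some \<open>f\<close> outside it, itself scaled against \<open>e\<close>.  Any two independent
  vectors are then linked by a triangle with \<open>e\<close> or \<open>f\<close>, unless they are coplanar with it; in
  that case a vector outside the plane serves as an intermediate step.
\<close>

lemma ex_linked_section:
  "\<exists>s. (\<forall>x. rep x (s x)) \<and> (\<forall>x y. E1.indep2 x y \<longrightarrow> rep (x - y) (s x - s y))"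
proof -
  obtain e where "e \<notin> E1.plane 0 0" using ex_not_in_plane by blast
  then have e: "e \<noteq> 0" using E1.fst_in_plane by auto
  obtain f where "f \<notin> E1.plane e 0" using ex_not_in_plane by blast
  with e have ef: "E1.indep2 e f" by (simp add: E1.indep2_iff_plane)
  obtain e' where e': "rep e e'" using rep_left_total by blast
  obtain f' where f': "linked e e' f f'" using ex_linked[OF e' ef] by blast
  then have rf: "rep f f'" by (simp add: linked_def)
  define s where "s x = (if x = 0 then 0 else if E1.indep2 e x
    then SOME x'. linked e e' x x' else SOME x'. linked f f' x x')" for x
  have s_gen: "linked e e' x (s x)" if "E1.indep2 e x" for x
  proof -
    have "x \<noteq> 0" using that by (auto simp: E1.indep2_iff_plane E1.in_plane_0_iff)
    then show ?thesis using that someI_ex[OF ex_linked[OF e' that]] by (simp add: s_def)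
  qed
  have s_f: "s f = f'" using linked_unique[OF s_gen[OF ef] f' ef] .
  have line: "E1.indep2 f x" if x: "\<not> E1.indep2 e x" "x \<noteq> 0" for x
  proof -
    obtain a where a: "x = scale1 a e" using E1.not_indep2D[OF x(1) e] by blast
    with x have "a \<noteq> 0" by auto
    then show ?thesis using E1.indep2_comb[of f e a 0] ef a by (simp add: E1.indep2_commute)
  qed
  have s_line: "linked f (s f) x (s x)" if "\<not> E1.indep2 e x" "x \<noteq> 0" for x
  proof -
    have "linked f f' x (s x)"
      using that someI_ex[OF ex_linked[OF rf line[OF that]]] by (simp add: s_def)
    then show ?thesis by (simp add: s_f)
  qed
  have rep_s: "rep x (s x)" for x
    using s_gen[of x] s_line[of x] rep_0_0 by (cases "x = 0") (auto simp: linked_def s_def)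
  \<comment> \<open>Independent vectors off the line of \<open>e\<close>; if coplanar with \<open>e\<close>, they are joined through \<open>z\<close>.\<close>
  have outside: "linked x (s x) y (s y)"
    if ind: "E1.indep2 e x" "E1.indep2 e y" "E1.indep2 x y" for x y
  proof (cases "E1.indep3 e x y")
    case True
    then show ?thesis using linked_triangle s_gen ind by blast
  next
    case False
    then have "e \<in> E1.plane x y"
      using E1.indep3_iff_plane E1.indep3_rotate ind(3) by blast
    then have sub: "E1.plane e x \<subseteq> E1.plane x y" "E1.plane e y \<subseteq> E1.plane x y"
      by (intro E1.plane_mono E1.fst_in_plane E1.snd_in_plane; simp)+
    obtain z where z: "z \<notin> E1.plane x y" using ex_not_in_plane by blast
    have i: "E1.indep3 e x z" "E1.indep3 e y z" "E1.indep3 x y z"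
      using z sub ind by (auto simp: E1.indep3_iff_plane)
    have "E1.indep2 e z" using E1.indep3D i(1) by blast
    then have "linked z (s z) x (s x)" "linked z (s z) y (s y)"
      using linked_triangle s_gen ind i linked_sym by blast+
    moreover have "E1.indep3 z x y" using i(3) E1.indep3_rotate by blast
    ultimately show ?thesis by (rule linked_triangle)
  qed
  \<comment> \<open>One vector on the line of \<open>e\<close>, where \<open>f\<close> takes over the role of \<open>e\<close>.\<close>
  have on_line: "linked x (s x) y (s y)"
    if x: "x \<noteq> 0" "\<not> E1.indep2 e x" and y: "E1.indep2 e y" and xy: "E1.indep2 x y" for x y
  proof -
    have fx: "linked f (s f) x (s x)" and ind_fx: "E1.indep2 f x"
      using s_line line x by blast+
    have *: "linked x (s x) z (s z)" if "E1.indep3 f x z" "E1.indep2 e z" for z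
      using linked_triangle[OF fx _ that(1)] outside[OF ef that(2)] E1.indep3D(2)[OF that(1)]
      by blast
    show ?thesis
    proof (cases "E1.indep3 f x y")
      case True
      then show ?thesis using * y by blast
    next
      case False
      obtain z where z: "z \<notin> E1.plane f x" using ex_not_in_plane by blast
      have yin: "y \<in> E1.plane f x" using False ind_fx by (simp add: E1.indep3_iff_plane)
      have "e \<in> E1.plane f x"
      proof -
        obtain a where a: "x = scale1 a e"
          using E1.not_indep2D[OF x(2) e] by blast
        with x have "a \<noteq> 0" by auto
        with a show ?thesis
          using E1.solve_in_plane[of 0 f "- 1" x a e]
          by (simp add: E1.lscale_minus_left E1.lscale_one)
      qed
      then have sub: "E1.plane e y \<subseteq> E1.plane f x" "E1.plane x y \<subseteq> E1.plane f x"
        using yin by (simp_all add: E1.plane_mono E1.snd_in_plane)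
      have i: "E1.indep3 f x z" "E1.indep3 e y z" "E1.indep3 x y z"
        using z sub ind_fx y xy by (auto simp: E1.indep3_iff_plane)
      have ez: "E1.indep2 e z" "E1.indep2 z y"
        using E1.indep3D i(2) E1.indep2_commute by blast+
      have "linked z (s z) x (s x)" using *[OF i(1) ez(1)] linked_sym by blast
      moreover have "linked z (s z) y (s y)" using outside ez y by blast
      moreover have "E1.indep3 z x y" using i(3) E1.indep3_rotate by blast
      ultimately show ?thesis by (rule linked_triangle)
    qed
  qed
  have "rep (x - y) (s x - s y)" if xy: "E1.indep2 x y" for x y
  proof -
    have nz: "x \<noteq> 0" "y \<noteq> 0" using xy E1.indep2_commute by (auto simp: E1.indep2_iff_plane)
    have one: "E1.indep2 e y" if "\<not> E1.indep2 e x"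
    proof (rule ccontr)
      assume "\<not> E1.indep2 e y"
      with that e obtain a b where "x = scale1 a e" "y = scale1 b e"
        using E1.not_indep2D by metis
      moreover from this nz have "a \<noteq> 0" by auto
      ultimately have "y = scale1 (b * inverse a) x"
        by (simp add: E1.lscale_lscale mult.assoc)
      then show False using xy by (auto simp: E1.indep2_iff_plane E1.in_plane_0_iff)
    qed
    have "linked x (s x) y (s y)"
      using outside on_line one nz xy linked_sym E1.indep2_commute by metis
    then show ?thesis by (simp add: linked_def)
  qed
  then show ?thesis using rep_s by blast
qed

end

section \<open>The coherent choice is a semi-linear bijection\<close>

locale linked_section = projective_correspondence scale1 scale2 rep
  for scale1 :: "'k1::division_ring \<Rightarrow> 'e1::ab_group_add \<Rightarrow> 'e1"
    and scale2 :: "'k2::division_ring \<Rightarrow> 'e2::ab_group_add \<Rightarrow> 'e2"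
    and rep +
  fixes s :: "'e1 \<Rightarrow> 'e2"
  assumes rep_s: "rep x (s x)"
    and rep_diff: "E1.indep2 x y \<Longrightarrow> rep (x - y) (s x - s y)"
begin

lemma s_eq_0_iff [simp]: "s x = 0 \<longleftrightarrow> x = 0"
  using rep_0_iff[OF rep_s] by simp

lemma s_0 [simp]: "s 0 = 0"
  by simp

lemma s_indep2: "E1.indep2 x y \<Longrightarrow> E2.indep2 (s x) (s y)"
  using rep_indep2[OF rep_s rep_s] by simp

lemma ex_indep2: "x \<noteq> 0 \<Longrightarrow> \<exists>y. E1.indep2 x y"
  using ex_not_in_plane[of x 0] by (auto simp: E1.indep2_iff_plane)

text \<open>
  Coherence of \<open>x + y\<close> with \<open>x\<close> and with \<open>y\<close> gives two expansions of \<open>s (x + y)\<close> in \<open>s x, s y\<close>, one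
  with coefficient 1 at \<open>s x\<close>, the other with coefficient 1 at \<open>s y\<close>.
\<close>

lemma s_add_indep:
  assumes "E1.indep2 x y"
  shows "s (x + y) = s x + s y"
proof -
  have along: "\<exists>c. s (u + v) - s u = scale2 c (s v)" if "E1.indep2 u v" for u v
    using rep_diff[of "u + v" u] E1.indep2_add[OF that] rep_unique[OF rep_s[of v]]
    by (simp add: E1.indep2_commute)
  obtain c where c: "s (x + y) - s x = scale2 c (s y)" using along assms by blast
  obtain d where d: "s (x + y) - s y = scale2 d (s x)"
    using along[of y x] assms by (auto simp: E1.indep2_commute add.commute)
  have "s (x + y) = scale2 1 (s x) + scale2 c (s y)"
    using c by (simp add: E2.lscale_one algebra_simps)
  moreover have "s (x + y) = scale2 d (s x) + scale2 1 (s y)"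
    using d by (simp add: E2.lscale_one algebra_simps)
  ultimately have "c = 1"
    using E2.indep2_coeffs_eq(2)[OF s_indep2[OF assms], of 1 c d 1] by simp
  then show ?thesis using c by (simp add: E2.lscale_one algebra_simps)
qed

text \<open>
  For dependent \<open>x, y\<close> choose \<open>z\<close> off their line and expand \<open>s (x + y + z)\<close> in two ways, each time
  through sums of independent vectors.
\<close>

lemma s_add: "s (x + y) = s x + s y"
proof (cases "x = 0 \<or> y = 0 \<or> E1.indep2 x y")
  case True
  then show ?thesis using s_add_indep by auto
next
  case False
  obtain z where z: "E1.indep2 x z" using ex_indep2 False by blast
  obtain a where a: "y = scale1 a x"
    using False E1.not_indep2D by blast
  with False have "a \<noteq> 0" by auto
  have yz: "E1.indep2 y z"
    using E1.indep2_comb[of z x a 0] z a \<open>a \<noteq> 0\<close> by (simp add: E1.indep2_commute)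
  have "E1.indep2 x (y + z)"
    using E1.indep2_comb[OF z, of 1 a] a by (simp add: E1.lscale_one)
  then have "s (x + y + z) = s x + (s y + s z)"
    using s_add_indep yz by (simp add: add.assoc)
  moreover have "s (x + y + z) = s (x + y) + s z"
  proof (cases "x + y = 0")
    case False
    have "x + y = scale1 (1 + a) x" using a by (simp add: E1.lscale_distribs E1.lscale_one)
    with False have "E1.indep2 z (x + y)"
      using E1.indep2_comb[of z x "1 + a" 0] z by (auto simp: E1.indep2_commute)
    then show ?thesis using s_add_indep E1.indep2_commute by blast
  qed simp
  ultimately show ?thesis by (simp add: add.assoc)
qed

lemma s_minus: "s (- x) = - s x"
  using s_add[of x "- x"] s_eq_0_iff[of 0] by (simp add: add_eq_0_iff)

lemma s_inj: "inj s"
proof (rule injI)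
  fix x y assume "s x = s y"
  then have "s (x - y) = 0" using s_add[of x "- y"] by (simp add: s_minus)
  then show "x = y" by simp
qed

lemma s_scale_along: "\<exists>c. s (scale1 a x) = scale2 c (s x)"
proof (cases "a = 0")
  case False
  then show ?thesis using rep_unique[OF rep_scale1[OF rep_s False] rep_s] by blast
qed (auto intro: exI[of _ 0])

text \<open>
  For independent \<open>x, y\<close> the multipliers of \<open>a\<close> at \<open>x\<close> and at \<open>y\<close> both equal the one at \<open>x + y\<close>.
  Two arbitrary nonzero vectors are compared through a third one, independent of each.
\<close>

lemma ex_companion:
  "\<exists>\<sigma>. \<forall>a x. s (scale1 a x) = scale2 (\<sigma> a) (s x)"
proof -
  have same: "c = d" if "E1.indep2 x y" "s (scale1 a x) = scale2 c (s x)"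
    "s (scale1 a y) = scale2 d (s y)" for a x y c d
  proof -
    obtain k where k: "s (scale1 a (x + y)) = scale2 k (s (x + y))"
      using s_scale_along by blast
    then have "scale2 c (s x) + scale2 d (s y) = scale2 k (s x) + scale2 k (s y)"
      using that by (simp add: E1.lscale_distribs E2.lscale_distribs s_add)
    then show ?thesis using E2.indep2_coeffs_eq[OF s_indep2[OF that(1)]] by metis
  qed
  obtain e where "e \<notin> E1.plane 0 0" using ex_not_in_plane by blast
  then have e: "e \<noteq> 0" using E1.fst_in_plane by auto
  obtain \<sigma> where \<sigma>: "s (scale1 a e) = scale2 (\<sigma> a) (s e)" for a
    using choice[of "\<lambda>a c. s (scale1 a e) = scale2 c (s e)"] s_scale_along by blast
  have "s (scale1 a x) = scale2 (\<sigma> a) (s x)" for a x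
  proof (cases "x = 0")
    case False
    obtain z where z: "z \<notin> E1.plane e x" using ex_not_in_plane by blast
    have "E1.plane e 0 \<subseteq> E1.plane e x" "E1.plane x 0 \<subseteq> E1.plane e x"
      by (intro E1.plane_mono E1.fst_in_plane E1.snd_in_plane E1.zero_in_plane)+
    with z e False have ind: "E1.indep2 e z" "E1.indep2 z x"
      using E1.indep2_commute by (auto simp: E1.indep2_iff_plane)
    obtain k where k: "s (scale1 a z) = scale2 k (s z)" using s_scale_along by blast
    obtain c where c: "s (scale1 a x) = scale2 c (s x)" using s_scale_along by blast
    show ?thesis using same[OF ind(1) \<sigma> k] same[OF ind(2) k c] c by simp
  qed simp
  then show ?thesis by blast
qed

text \<open>
  Only surjectivity does not follow at once from the properties of \<open>s\<close>.  Given \<open>c\<close>, the vector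
  \<open>c (s e) + s z\<close> corresponds to some \<open>w = a e + b z\<close>, so it is proportional to
  \<open>\<sigma> a (s e) + \<sigma> b (s z)\<close>; comparing coefficients gives \<open>c = \<sigma> (inverse b) * \<sigma> a\<close>.
\<close>

lemma companion_field_isomorphism:
  assumes \<sigma>: "\<And>a x. s (scale1 a x) = scale2 (\<sigma> a) (s x)"
  shows "field_isomorphism \<sigma>"
proof -
  obtain e where "e \<notin> E1.plane 0 0" using ex_not_in_plane by blast
  then have e: "e \<noteq> 0" using E1.fst_in_plane by auto
  have cancel: "a = b" if "scale2 a (s e) = scale2 b (s e)" for a b
    using that e E2.lscale_eq_0_iff[of "a - b" "s e"] by (simp add: E2.lscale_distribs)
  have add: "\<sigma> (a + b) = \<sigma> a + \<sigma> b" for a b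
    by (rule cancel) (simp add: E1.lscale_distribs E2.lscale_distribs s_add flip: \<sigma>)
  have mult: "\<sigma> (a * b) = \<sigma> a * \<sigma> b" for a b
    by (rule cancel) (metis \<sigma> E1.lscale_lscale E2.lscale_lscale)
  have one: "\<sigma> 1 = 1"
    by (rule cancel) (simp add: E1.lscale_one E2.lscale_one flip: \<sigma>)
  have "inj \<sigma>"
  proof (rule injI)
    fix a b assume "\<sigma> a = \<sigma> b"
    then have "s (scale1 a e) = s (scale1 b e)" by (simp add: \<sigma>)
    then have "scale1 a e = scale1 b e" using s_inj by (simp add: inj_eq)
    then show "a = b" using e E1.lscale_eq_0_iff[of "a - b" e] by (simp add: E1.lscale_distribs)
  qed
  moreover have "surj \<sigma>"
    unfolding surj_def
  proof
    fix c
    obtain z where z: "E1.indep2 e z" using ex_indep2[OF e] by blast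
    obtain w where w: "rep w (scale2 c (s e) + s z)" using rep_right_total by blast
    have "scale2 c (s e) + s z \<in> E2.plane (s e) (s z)"
      using E2.in_plane[of c "s e" 1] by (simp add: E2.lscale_one)
    then have "w \<in> E1.plane e z" using rep_plane[OF rep_s rep_s w] by blast
    then obtain a b where "w = scale1 a e + scale1 b z" by (auto simp: E1.in_plane_iff)
    then have sw: "s w = scale2 (\<sigma> a) (s e) + scale2 (\<sigma> b) (s z)" by (simp add: s_add \<sigma>)
    obtain d where "scale2 c (s e) + s z = scale2 d (s w)" using rep_unique[OF rep_s w] by blast
    then have "scale2 c (s e) + scale2 1 (s z) = scale2 (d * \<sigma> a) (s e) + scale2 (d * \<sigma> b) (s z)"
      using sw by (simp add: E2.lscale_distribs E2.lscale_lscale E2.lscale_one)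
    then have c: "c = d * \<sigma> a" "1 = d * \<sigma> b"
      using E2.indep2_coeffs_eq[OF s_indep2[OF z]] by blast+
    have "b \<noteq> 0"
    proof
      assume "b = 0"
      then have "\<sigma> b = 0" using add[of 0 0] by simp
      then show False using c(2) by simp
    qed
    have "d = d * \<sigma> (b * inverse b)" using one \<open>b \<noteq> 0\<close> by simp
    also have "\<dots> = \<sigma> (inverse b)" using c(2) by (simp add: mult flip: mult.assoc)
    finally show "\<exists>a. c = \<sigma> a" using c(1) mult by metis
  qed
  ultimately show ?thesis unfolding field_isomorphism_def bij_def
    using add mult one by blast
qed

lemma s_semi_linear: "semi_linear scale1 scale2 s"
  using ex_companion companion_field_isomorphism s_add
  unfolding semi_linear_def additive_def by blast

lemma s_bij: "bij s"
proof -
  obtain \<sigma> where \<sigma>: "field_isomorphism \<sigma>" "\<And>a x. s (scale1 a x) = scale2 (\<sigma> a) (s x)"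
    using s_semi_linear by (auto simp: semi_linear_def)
  have "\<exists>x. y' = s x" for y'
  proof -
    obtain x where "rep x y'" using rep_right_total by blast
    then obtain c where c: "y' = scale2 c (s x)" using rep_unique[OF rep_s] by blast
    obtain a where "c = \<sigma> a" using \<sigma>(1) by (metis field_isomorphism_def bij_def surjD)
    then show ?thesis using c \<sigma>(2) by metis
  qed
  then show ?thesis using s_inj unfolding bij_def surj_def by blast
qed

end

section \<open>From lattice isomorphisms to collineations\<close>

lemma lattice_isomorphism_subset_iff:
  assumes "lattice_isomorphism (closed_lattice l1 B1) (closed_lattice l2 B2) \<psi>"
    and "F_closed l1 B1 M" "F_closed l1 B1 N"
  shows "\<psi> M \<subseteq> \<psi> N \<longleftrightarrow> M \<subseteq> N"
proof -
  let ?L1 = "closed_lattice l1 B1" and ?L2 = "closed_lattice l2 B2"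
  interpret L1: complete_lattice ?L1 by (rule complete_lattice_closed_lattice)
  interpret L2: complete_lattice ?L2 by (rule complete_lattice_closed_lattice)
  have M: "M \<in> carrier ?L1" and N: "N \<in> carrier ?L1"
    using assms by (auto simp: closed_lattice_def)
  have bij: "bij_betw \<psi> (carrier ?L1) (carrier ?L2)"
    and meet: "\<psi> (M \<sqinter>\<^bsub>?L1\<^esub> N) = \<psi> M \<sqinter>\<^bsub>?L2\<^esub> \<psi> N"
    using assms(1) M N by (auto simp: lattice_isomorphism_def)
  have M': "\<psi> M \<in> carrier ?L2" and N': "\<psi> N \<in> carrier ?L2"
    using bij M N by (auto simp: bij_betw_def)
  have "\<psi> M \<subseteq> \<psi> N \<longleftrightarrow> \<psi> M = \<psi> (M \<sqinter>\<^bsub>?L1\<^esub> N)"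
    using L2.le_iff_join[OF M' N'] meet by (simp add: closed_lattice_def)
  also have "\<dots> \<longleftrightarrow> M = M \<sqinter>\<^bsub>?L1\<^esub> N"
    using bij M L1.meet_closed[OF M N] by (auto simp: bij_betw_def dest: inj_onD)
  also have "\<dots> \<longleftrightarrow> M \<subseteq> N"
    using L1.le_iff_join[OF M N] by (simp add: closed_lattice_def)
  finally show ?thesis .
qed

definition corresponding :: "('e1 set \<Rightarrow> bool) \<Rightarrow> ('e1 set \<Rightarrow> 'e2 set) \<Rightarrow> 'e1 \<Rightarrow> 'e2 \<Rightarrow> bool"
  where "corresponding C \<psi> x x' \<longleftrightarrow> (\<forall>M. C M \<longrightarrow> (x \<in> M \<longleftrightarrow> x' \<in> \<psi> M))"

text \<open>
  Lines are the minimal nonzero closed subspaces, so \<open>\<psi>\<close> matches the lines of \<open>E1\<close> with those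
  of \<open>E2\<close>; this makes the relation total on both sides.  Collinearity is preserved by
  \<open>in_plane_iff_closed\<close>.
\<close>

lemma projective_correspondence_of_lattice_isomorphism:
  fixes lscale1 :: "'k1::division_ring \<Rightarrow> 'e1::ab_group_add \<Rightarrow> 'e1"
    and rscale1 :: "'f1::ab_group_add \<Rightarrow> 'k1 \<Rightarrow> 'f1"
    and lscale2 :: "'k2::division_ring \<Rightarrow> 'e2::ab_group_add \<Rightarrow> 'e2"
    and rscale2 :: "'f2::ab_group_add \<Rightarrow> 'k2 \<Rightarrow> 'f2"
  assumes dp1: "dual_pair lscale1 rscale1 B1"
    and dp2: "dual_pair lscale2 rscale2 B2"
    and dim: "card S = 3" "left_independent lscale1 S"
    and iso: "lattice_isomorphism (closed_lattice lscale1 B1) (closed_lattice lscale2 B2) \<psi>"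
  shows "projective_correspondence lscale1 lscale2 (corresponding (F_closed lscale1 B1) \<psi>)"
proof -
  interpret E1: dual_pair lscale1 rscale1 B1 by (rule dp1)
  interpret E2: dual_pair lscale2 rscale2 B2 by (rule dp2)
  have bij: "bij_betw \<psi> {M. E1.ortho_closed M} {N. E2.ortho_closed N}"
    using iso by (simp add: lattice_isomorphism_def closed_lattice_def)
  have mono: "\<psi> M \<subseteq> \<psi> N \<longleftrightarrow> M \<subseteq> N" if "E1.ortho_closed M" "E1.ortho_closed N" for M N
    using lattice_isomorphism_subset_iff[OF iso that] .
  have into: "E2.ortho_closed (\<psi> M)" if "E1.ortho_closed M" for M
    using bij that by (auto simp: bij_betw_def)
  have onto: "\<exists>M. E1.ortho_closed M \<and> N = \<psi> M" if "E2.ortho_closed N" for N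
    using bij that unfolding bij_betw_def by blast
  have in1: "x \<in> M \<longleftrightarrow> E1.plane x 0 \<subseteq> M" if "E1.ortho_closed M" for x M
    using that E1.plane_least E1.fst_in_plane by (auto simp: F_closed_def left_subspace_def)
  have in2: "x \<in> M \<longleftrightarrow> E2.plane x 0 \<subseteq> M" if "E2.ortho_closed M" for x M
    using that E2.plane_least E2.fst_in_plane by (auto simp: F_closed_def left_subspace_def)
  have sub1: "left_subspace lscale1 M" if "E1.ortho_closed M" for M
    using that by (simp add: F_closed_def)
  have sub2: "left_subspace lscale2 M" if "E2.ortho_closed M" for M
    using that by (simp add: F_closed_def)
  have zero1: "0 \<in> M" if "E1.ortho_closed M" for M
    using sub1[OF that] by (simp add: left_subspace_def)
  have zero2: "0 \<in> M" if "E2.ortho_closed M" for M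
    using sub2[OF that] by (simp add: left_subspace_def)
  have psi_zero: "\<psi> {0} = {0}"
    using onto[OF E2.closed_zero] mono[OF E1.closed_zero] zero1 zero2 into E1.closed_zero by blast
  have psi_zero_iff: "\<psi> M = {0} \<longleftrightarrow> M = {0}" if "E1.ortho_closed M" for M
    using bij_betw_imp_inj_on[OF bij] inj_on_eq_iff[of \<psi> _ M "{0}"] psi_zero that E1.closed_zero
    by (metis mem_Collect_eq)
  let ?R = "corresponding (F_closed lscale1 B1) \<psi>"
  have R: "?R x x'" if "\<psi> (E1.plane x 0) = E2.plane x' 0" for x x'
    unfolding corresponding_def
  proof (intro allI impI)
    fix M assume M: "E1.ortho_closed M"
    show "x \<in> M \<longleftrightarrow> x' \<in> \<psi> M"
      using mono[OF E1.closed_plane M, of x 0] that in1[OF M] in2[OF into[OF M]] by simp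
  qed
  have R00: "?R 0 0" using zero1 zero2 into by (auto simp: corresponding_def)
  show ?thesis
  proof
    fix x
    show "\<exists>x'. ?R x x'"
    proof (cases "x = 0")
      case False
      then have "E1.plane x 0 \<noteq> {0}" using E1.fst_in_plane[of x 0] by auto
      then obtain x' where x': "x' \<in> \<psi> (E1.plane x 0)" "x' \<noteq> 0"
        using psi_zero_iff[OF E1.closed_plane] zero2[OF into[OF E1.closed_plane]] by blast
      obtain N where N: "E1.ortho_closed N" "E2.plane x' 0 = \<psi> N"
        using onto[OF E2.closed_plane] by blast
      have "N \<subseteq> E1.plane x 0"
        using x' in2[OF into[OF E1.closed_plane]] N(2) mono[OF N(1) E1.closed_plane] by simp
      moreover have "N \<noteq> {0}"
        using psi_zero_iff[OF N(1)] N(2) x'(2) E2.fst_in_plane[of x' 0] by auto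
      ultimately have "N = E1.plane x 0" using E1.line_minimal[OF sub1[OF N(1)]] by blast
      then show ?thesis using R N(2) by metis
    qed (use R00 in blast)
  next
    fix x'
    show "\<exists>x. ?R x x'"
    proof (cases "x' = 0")
      case False
      obtain N where N: "E1.ortho_closed N" "E2.plane x' 0 = \<psi> N"
        using onto[OF E2.closed_plane] by blast
      have "N \<noteq> {0}"
        using psi_zero_iff[OF N(1)] N(2) False E2.fst_in_plane[of x' 0] by auto
      then obtain x where x: "x \<in> N" "x \<noteq> 0" using zero1[OF N(1)] by blast
      have "\<psi> (E1.plane x 0) \<subseteq> E2.plane x' 0"
        using x(1) in1[OF N(1)] mono[OF E1.closed_plane N(1)] N(2) by simp
      moreover have "\<psi> (E1.plane x 0) \<noteq> {0}"
        using psi_zero_iff[OF E1.closed_plane] x(2) E1.fst_in_plane[of x 0] by auto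
      ultimately have "\<psi> (E1.plane x 0) = E2.plane x' 0"
        using E2.line_minimal[OF sub2[OF into[OF E1.closed_plane]]] by blast
      then show ?thesis using R by blast
    qed (use R00 in blast)
  next
    fix x x' and a :: 'k1 and b :: 'k2 assume "?R x x'" "a \<noteq> 0" "b \<noteq> 0"
    then show "?R (lscale1 a x) (lscale2 b x')"
      using E1.closed_scale_iff E2.closed_scale_iff into by (simp add: corresponding_def)
  next
    fix x x' y y' z z' assume "?R x x'" "?R y y'" "?R z z'"
    then have eq: "x \<in> M \<longleftrightarrow> x' \<in> \<psi> M" "y \<in> M \<longleftrightarrow> y' \<in> \<psi> M" "z \<in> M \<longleftrightarrow> z' \<in> \<psi> M"
      if "E1.ortho_closed M" for M
      using that by (simp_all add: corresponding_def)
    have "z \<in> E1.plane x y \<longleftrightarrow> (\<forall>M. E1.ortho_closed M \<longrightarrow> x' \<in> \<psi> M \<longrightarrow> y' \<in> \<psi> M \<longrightarrow> z' \<in> \<psi> M)"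
      unfolding E1.in_plane_iff_closed using eq by blast
    also have "\<dots> \<longleftrightarrow> z' \<in> E2.plane x' y'"
      unfolding E2.in_plane_iff_closed using onto into by metis
    finally show "z \<in> E1.plane x y \<longleftrightarrow> z' \<in> E2.plane x' y'" .
  next
    show "\<exists>z. z \<notin> E1.plane x y" for x y using E1.ex_not_in_plane[OF dim] .
  qed
qed

theorem proposition2:
  fixes lscale1 :: "'k1::division_ring \<Rightarrow> 'e1::ab_group_add \<Rightarrow> 'e1"
    and rscale1 :: "'f1::ab_group_add \<Rightarrow> 'k1 \<Rightarrow> 'f1"
    and B1 :: "'e1 \<Rightarrow> 'f1 \<Rightarrow> 'k1"
    and lscale2 :: "'k2::division_ring \<Rightarrow> 'e2::ab_group_add \<Rightarrow> 'e2"
    and rscale2 :: "'f2::ab_group_add \<Rightarrow> 'k2 \<Rightarrow> 'f2"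
    and B2 :: "'e2 \<Rightarrow> 'f2 \<Rightarrow> 'k2"
    and \<psi> :: "'e1 set \<Rightarrow> 'e2 set"
  assumes "dual_pair lscale1 rscale1 B1"
    and "dual_pair lscale2 rscale2 B2"
    and dim_ge_3: "\<exists>S. card S = 3 \<and> left_independent lscale1 S"
    and "lattice_isomorphism (closed_lattice lscale1 B1) (closed_lattice lscale2 B2) \<psi>"
  shows "(\<exists>\<sigma> :: 'k1 \<Rightarrow> 'k2. field_isomorphism \<sigma>) \<and>
    (\<exists>s :: 'e1 \<Rightarrow> 'e2. semi_linear lscale1 lscale2 s \<and> bij s \<and>
      (\<forall>M. F_closed lscale1 B1 M \<longrightarrow> \<psi> M = s ` M))"
proof -
  let ?R = "corresponding (F_closed lscale1 B1) \<psi>"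
  obtain S where S: "card S = 3" "left_independent lscale1 S" using dim_ge_3 by (elim exE conjE)
  interpret projective_correspondence lscale1 lscale2 ?R
    by (rule projective_correspondence_of_lattice_isomorphism[OF assms(1,2) S assms(4)])
  obtain s where s: "\<forall>x. ?R x (s x)" "\<forall>x y. E1.indep2 x y \<longrightarrow> ?R (x - y) (s x - s y)"
    using ex_linked_section by (elim exE conjE)
  interpret linked_section lscale1 lscale2 ?R s
    by standard (simp_all add: s)
  have "\<psi> M = s ` M" if "F_closed lscale1 B1 M" for M
  proof -
    have "x \<in> M \<longleftrightarrow> s x \<in> \<psi> M" for x
      using s(1) that by (simp add: corresponding_def)
    then have "M = s -` \<psi> M" by auto
    then show ?thesis using surj_image_vimage_eq[OF bij_is_surj[OF s_bij], of "\<psi> M"] by simp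
  qed
  moreover have "\<exists>\<sigma> :: 'k1 \<Rightarrow> 'k2. field_isomorphism \<sigma>"
    using s_semi_linear by (auto simp: semi_linear_def)
  ultimately show ?thesis using s_semi_linear s_bij by blast
qed

end
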